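(* Let $\mathbf V\subseteq\mathbf{M^{+}S4}$. Then $d(\mathbf V)\le n$ iff $d^0(\mathbf V)\le n$; equivalently, $\mathbf V\models P_n$ iff $\mathbf V\models P^0_n$.
   Context: $\mathsf{MS4}$-algebras are $(B,\lozenge,\exists)$ with $\lozenge$ an $\mathsf{S4}$ operator, $\exists$ an $\mathsf{S5}$ operator and $\exists\lozenge a\le\lozenge\exists a$; $\square=\neg\lozenge\neg$, $\forall=\neg\exists\neg$. $\mathbf{M^{+}S4}=\mathbf{MS4}+\mathsf{M^{+}Cas}$, $\mathsf{M^{+}Cas}=\square\forall(\square(\square p\to\square\forall p)\to\square\forall p)\to\square\forall p$. $P_1=\lozenge\square q_1\to\square q_1$, $P_n=\lozenge(\square q_n\wedge\neg P_{n-1})\to\square q_n$; $P^0_n$ is $P_n$ with $\lozenge$ replaced by $\lozenge\exists$ (and $\square$ by $\square\forall$). $d(\mathbf V)$ is the supremum of depths ($\lozenge$-depths) of algebras in $\mathbf V$; $d^0(\mathbf V)$ the supremum of depths of the $\mathsf{S4}$-algebras $\mathfrak A^0$ of $\exists$-fixpoints with restricted $\lozenge$ (i.e. the $\lozenge\exists$-depth). $\mathbf V\models P_n$ iff $d(\mathbf V)\le n$, and $\mathbf V\models P^0_n$ iff $d^0(\mathbf V)\le n$. *)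

theory Defs
  imports "HOL-Library.Extended_Nat" "HOL-Algebra.Congruence"
begin

section \<open>Algebras\<close>

text \<open>
  A variety is a class of algebras on varying carriers.  Algebras are therefore records with a
  carrier set inside a type \<open>'a\<close>; the values of the operations outside the carrier
  are irrelevant.
\<close>

record 'a bool_alg = "'a partial_object" +
  bmeet :: "'a \<Rightarrow> 'a \<Rightarrow> 'a"
  bjoin :: "'a \<Rightarrow> 'a \<Rightarrow> 'a"
  bneg :: "'a \<Rightarrow> 'a"
  bbot :: 'a
  btop :: 'a

record 'a s4_alg = "'a bool_alg" +
  dia :: "'a \<Rightarrow> 'a"

record 'a ms4_alg = "'a s4_alg" +
  exs :: "'a \<Rightarrow> 'a"

definition ble :: "('a, 'z) bool_alg_scheme \<Rightarrow> 'a \<Rightarrow> 'a \<Rightarrow> bool" where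
  "ble A a b \<longleftrightarrow> bmeet A a b = a"

locale bool_algebra =
  fixes A :: "('a, 'z) bool_alg_scheme"
  assumes meet_closed: "a \<in> carrier A \<Longrightarrow> b \<in> carrier A \<Longrightarrow> bmeet A a b \<in> carrier A"
    and join_closed: "a \<in> carrier A \<Longrightarrow> b \<in> carrier A \<Longrightarrow> bjoin A a b \<in> carrier A"
    and neg_closed: "a \<in> carrier A \<Longrightarrow> bneg A a \<in> carrier A"
    and bot_closed: "bbot A \<in> carrier A"
    and top_closed: "btop A \<in> carrier A"
    and meet_assoc: "a \<in> carrier A \<Longrightarrow> b \<in> carrier A \<Longrightarrow> c \<in> carrier A \<Longrightarrow>
          bmeet A (bmeet A a b) c = bmeet A a (bmeet A b c)"
    and meet_commute: "a \<in> carrier A \<Longrightarrow> b \<in> carrier A \<Longrightarrow> bmeet A a b = bmeet A b a"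
    and join_assoc: "a \<in> carrier A \<Longrightarrow> b \<in> carrier A \<Longrightarrow> c \<in> carrier A \<Longrightarrow>
          bjoin A (bjoin A a b) c = bjoin A a (bjoin A b c)"
    and join_commute: "a \<in> carrier A \<Longrightarrow> b \<in> carrier A \<Longrightarrow> bjoin A a b = bjoin A b a"
    and meet_join_distrib: "a \<in> carrier A \<Longrightarrow> b \<in> carrier A \<Longrightarrow> c \<in> carrier A \<Longrightarrow>
          bmeet A a (bjoin A b c) = bjoin A (bmeet A a b) (bmeet A a c)"
    and join_meet_distrib: "a \<in> carrier A \<Longrightarrow> b \<in> carrier A \<Longrightarrow> c \<in> carrier A \<Longrightarrow>
          bjoin A a (bmeet A b c) = bmeet A (bjoin A a b) (bjoin A a c)"
    and meet_top: "a \<in> carrier A \<Longrightarrow> bmeet A a (btop A) = a"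
    and join_bot: "a \<in> carrier A \<Longrightarrow> bjoin A a (bbot A) = a"
    and meet_neg: "a \<in> carrier A \<Longrightarrow> bmeet A a (bneg A a) = bbot A"
    and join_neg: "a \<in> carrier A \<Longrightarrow> bjoin A a (bneg A a) = btop A"

locale s4_operator =
  fixes A :: "('a, 'z) bool_alg_scheme" and f :: "'a \<Rightarrow> 'a"
  assumes op_closed: "a \<in> carrier A \<Longrightarrow> f a \<in> carrier A"
    and op_bot: "f (bbot A) = bbot A"
    and op_join: "a \<in> carrier A \<Longrightarrow> b \<in> carrier A \<Longrightarrow> f (bjoin A a b) = bjoin A (f a) (f b)"
    and op_increasing: "a \<in> carrier A \<Longrightarrow> ble A a (f a)"
    and op_transitive: "a \<in> carrier A \<Longrightarrow> ble A (f (f a)) (f a)"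

text \<open>The additional axiom is \<open>a \<le> \<forall>\<exists>a\<close>, with \<open>\<forall> = \<not>\<exists>\<not>\<close>.\<close>

locale s5_operator = s4_operator +
  assumes op_symmetric: "a \<in> carrier A \<Longrightarrow> ble A a (bneg A (f (bneg A (f a))))"

locale s4_algebra = bool_algebra A + s4_operator A "dia A"
  for A :: "('a, 'z) s4_alg_scheme"

locale ms4_algebra = bool_algebra A + dia: s4_operator A "dia A" + exs: s5_operator A "exs A"
  for A :: "('a, 'z) ms4_alg_scheme" +
  assumes ex_dia_le: "a \<in> carrier A \<Longrightarrow> ble A (exs A (dia A a)) (dia A (exs A a))"

text \<open>The \<open>S4\<close>-algebra of \<open>\<exists>\<close>-fixpoints, with the restricted operations.\<close>

definition fixpoint_algebra :: "('a, 'z) ms4_alg_scheme \<Rightarrow> 'a s4_alg" where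
  "fixpoint_algebra A =
     \<lparr>carrier = {a \<in> carrier A. exs A a = a}, bmeet = bmeet A, bjoin = bjoin A, bneg = bneg A,
      bbot = bbot A, btop = btop A, dia = dia A\<rparr>"

section \<open>Depth\<close>

definition ultrafilter :: "('a, 'z) bool_alg_scheme \<Rightarrow> 'a set \<Rightarrow> bool" where
  "ultrafilter A F \<longleftrightarrow>
     F \<subseteq> carrier A \<and> btop A \<in> F \<and> bbot A \<notin> F \<and>
     (\<forall>a\<in>F. \<forall>b\<in>F. bmeet A a b \<in> F) \<and>
     (\<forall>a\<in>F. \<forall>b\<in>carrier A. ble A a b \<longrightarrow> b \<in> F) \<and>
     (\<forall>a\<in>carrier A. a \<in> F \<or> bneg A a \<in> F)"

text \<open>The accessibility relation of the dual frame, whose points are the ultrafilters.\<close>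

definition dual_rel :: "('a, 'z) s4_alg_scheme \<Rightarrow> 'a set \<Rightarrow> 'a set \<Rightarrow> bool" where
  "dual_rel A F G \<longleftrightarrow> (\<forall>a\<in>G. dia A a \<in> F)"

definition proper_chain :: "('a, 'z) s4_alg_scheme \<Rightarrow> 'a set list \<Rightarrow> bool" where
  "proper_chain A Fs \<longleftrightarrow>
     (\<forall>F\<in>set Fs. ultrafilter A F) \<and>
     successively (\<lambda>F G. dual_rel A F G \<and> \<not> dual_rel A G F) Fs"

text \<open>
  The depth of an algebra is the number of points in a longest proper chain of its dual frame
  (\<open>\<infinity>\<close> if unbounded, 0 for the trivial algebra).
\<close>

definition depth :: "('a, 'z) s4_alg_scheme \<Rightarrow> enat" where
  "depth A = Sup {enat (length Fs) | Fs. proper_chain A Fs}"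

definition var_depth :: "'a ms4_alg set \<Rightarrow> enat" where
  "var_depth V = (SUP A\<in>V. depth A)"

definition var_depth0 :: "'a ms4_alg set \<Rightarrow> enat" where
  "var_depth0 V = (SUP A\<in>V. depth (fixpoint_algebra A))"

section \<open>Terms, validity and varieties\<close>

datatype fm =
    Var nat
  | Bot
  | Top
  | Neg fm
  | And fm fm
  | Or fm fm
  | Dia fm
  | Exi fm

abbreviation Imp :: "fm \<Rightarrow> fm \<Rightarrow> fm" where "Imp \<phi> \<psi> \<equiv> Or (Neg \<phi>) \<psi>"
abbreviation Box :: "fm \<Rightarrow> fm" where "Box \<phi> \<equiv> Neg (Dia (Neg \<phi>))"
abbreviation Univ :: "fm \<Rightarrow> fm" where "Univ \<phi> \<equiv> Neg (Exi (Neg \<phi>))"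

primrec eval :: "('a, 'z) ms4_alg_scheme \<Rightarrow> (nat \<Rightarrow> 'a) \<Rightarrow> fm \<Rightarrow> 'a" where
  "eval A v (Var i) = v i"
| "eval A v Bot = bbot A"
| "eval A v Top = btop A"
| "eval A v (Neg \<phi>) = bneg A (eval A v \<phi>)"
| "eval A v (And \<phi> \<psi>) = bmeet A (eval A v \<phi>) (eval A v \<psi>)"
| "eval A v (Or \<phi> \<psi>) = bjoin A (eval A v \<phi>) (eval A v \<psi>)"
| "eval A v (Dia \<phi>) = dia A (eval A v \<phi>)"
| "eval A v (Exi \<phi>) = exs A (eval A v \<phi>)"

definition satisfies_eq :: "('a, 'z) ms4_alg_scheme \<Rightarrow> fm \<Rightarrow> fm \<Rightarrow> bool" where
  "satisfies_eq A \<phi> \<psi> \<longleftrightarrow> (\<forall>v. range v \<subseteq> carrier A \<longrightarrow> eval A v \<phi> = eval A v \<psi>)"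

definition valid :: "'a ms4_alg set \<Rightarrow> fm \<Rightarrow> bool" where
  "valid V \<phi> \<longleftrightarrow> (\<forall>A\<in>V. satisfies_eq A \<phi> Top)"

definition MS4 :: "'a ms4_alg set" where
  "MS4 = {A. ms4_algebra A}"

text \<open>
  Varieties of \<open>MS4\<close>-algebras are the classes defined by sets of equations.  Closure under
  homomorphic images, subalgebras and products is not used as the definition, since
  products need not live in the type \<open>'a\<close>.
\<close>

definition variety :: "'a ms4_alg set \<Rightarrow> bool" where
  "variety V \<longleftrightarrow> (\<exists>\<Gamma>. V = {A \<in> MS4. \<forall>(\<phi>, \<psi>)\<in>\<Gamma>. satisfies_eq A \<phi> \<psi>})"

definition MpCas :: fm where
  "MpCas = (let p = Var 0 in
     Imp (Box (Univ (Imp (Box (Imp (Box p) (Box (Univ p)))) (Box (Univ p))))) (Box (Univ p)))"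

definition MpS4 :: "'a ms4_alg set" where
  "MpS4 = {A \<in> MS4. satisfies_eq A MpCas Top}"

text \<open>
  The formulas start at index 1; index 0 is the usual convention that falsum is valid
  exactly in the classes of trivial algebras, i.e. those of depth 0.
\<close>

fun P_form :: "nat \<Rightarrow> fm" where
  "P_form 0 = Bot"
| "P_form (Suc 0) = Imp (Dia (Box (Var 1))) (Box (Var 1))"
| "P_form (Suc (Suc n)) =
     Imp (Dia (And (Box (Var (Suc (Suc n)))) (Neg (P_form (Suc n))))) (Box (Var (Suc (Suc n))))"

fun P0_form :: "nat \<Rightarrow> fm" where
  "P0_form 0 = Bot"
| "P0_form (Suc 0) = Imp (Dia (Exi (Box (Univ (Var 1))))) (Box (Univ (Var 1)))"
| "P0_form (Suc (Suc n)) =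
     Imp (Dia (Exi (And (Box (Univ (Var (Suc (Suc n))))) (Neg (P0_form (Suc n))))))
       (Box (Univ (Var (Suc (Suc n)))))"

end

(* The fixpoints of \<exists> form an S4-subalgebra of (B, \<diamond>), and on them P^0_n is P_n evaluated at the
   elements \<forall>q_i. This gives d^0 \<le> d, and the Jonsson-Tarski representation of an S4-algebra by its
   ultrafilters turns both depth conditions into validity of P_n, algebra by algebra.

   For the converse let a_i be the value of P_i under an arbitrary valuation, and let c_i be the
   value of P^0_i when q_i is interpreted as a_i. By induction \<box>c_i \<le> a_i: with
   b = \<box>\<forall>a_i, the Casari axiom at a_i reduces \<box>c_i \<le> b to
   \<box>c_i \<and> \<box>(\<box>a_i \<rightarrow> b) \<le> b. A point of the left-hand side either satisfies \<box>a_i, hence b, or it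
   sees a point w with \<box>q_i and \<not>a_{i-1}; then w satisfies \<box>a_i, hence b, and by the induction
   hypothesis it sees a point with b and \<not>c_{i-1}, so that c_i yields b. If P^0_n is valid, then
   c_n = 1 and therefore a_n = 1. *)

theory Submission
  imports Defs
begin

section \<open>Ultrafilters of Boolean algebras\<close>

context bool_algebra
begin

section \<open>Order laws derived from the Boolean axioms\<close>

lemma meet_idem:
  assumes a: "a \<in> carrier A"
  shows "bmeet A a a = a"
proof -
  have "bmeet A a (bjoin A a (bneg A a)) = bjoin A (bmeet A a a) (bmeet A a (bneg A a))"
    by (rule meet_join_distrib[OF a a neg_closed[OF a]])
  then show ?thesis using a by (simp add: join_neg meet_top meet_neg join_bot meet_closed)
qed

lemma top_join:
  assumes b: "b \<in> carrier A"
  shows "bjoin A (btop A) b = btop A"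
proof -
  have "bjoin A b (bmeet A (bneg A b) (btop A)) =
      bmeet A (bjoin A b (bneg A b)) (bjoin A b (btop A))"
    by (rule join_meet_distrib[OF b neg_closed[OF b] top_closed])
  then have "bmeet A (btop A) (bjoin A b (btop A)) = btop A"
    using b by (simp add: join_neg meet_top neg_closed)
  then have "bmeet A (bjoin A b (btop A)) (btop A) = btop A"
    using b by (simp add: meet_commute join_closed top_closed)
  then show ?thesis
    using b by (simp add: meet_top join_closed top_closed join_commute)
qed

lemma absorb:
  assumes a: "a \<in> carrier A" and b: "b \<in> carrier A"
  shows "bmeet A a (bjoin A a b) = a"
proof -
  have "bmeet A a (bjoin A (btop A) b) = bjoin A (bmeet A a (btop A)) (bmeet A a b)"
    by (rule meet_join_distrib[OF a top_closed b])
  moreover have "bmeet A a (bjoin A a b) = bjoin A (bmeet A a a) (bmeet A a b)"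
    by (rule meet_join_distrib[OF a a b])
  ultimately show ?thesis using a b by (simp add: meet_idem meet_top top_join)
qed

lemma meet_bot:
  assumes a: "a \<in> carrier A"
  shows "bmeet A a (bbot A) = bbot A"
  using meet_assoc[OF a a neg_closed[OF a]] a by (simp add: meet_idem meet_neg)

lemma ble_refl: "a \<in> carrier A \<Longrightarrow> ble A a a"
  by (simp add: ble_def meet_idem)

lemma ble_trans:
  assumes "a \<in> carrier A" "b \<in> carrier A" "c \<in> carrier A" "ble A a b" "ble A b c"
  shows "ble A a c"
  using assms unfolding ble_def by (metis meet_assoc)

lemma meet_ble1: "a \<in> carrier A \<Longrightarrow> b \<in> carrier A \<Longrightarrow> ble A (bmeet A a b) a"
  unfolding ble_def by (metis meet_assoc meet_closed meet_commute meet_idem)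

lemma meet_ble2: "a \<in> carrier A \<Longrightarrow> b \<in> carrier A \<Longrightarrow> ble A (bmeet A a b) b"
  unfolding ble_def by (metis meet_assoc meet_idem)

lemma ble_join1: "a \<in> carrier A \<Longrightarrow> b \<in> carrier A \<Longrightarrow> ble A a (bjoin A a b)"
  by (simp add: ble_def absorb)

lemma ble_join2: "a \<in> carrier A \<Longrightarrow> b \<in> carrier A \<Longrightarrow> ble A b (bjoin A a b)"
  by (metis ble_join1 join_commute)

lemma meet_mono:
  assumes "a \<in> carrier A" "b \<in> carrier A" "c \<in> carrier A" "d \<in> carrier A" "ble A a c" "ble A b d"
  shows "ble A (bmeet A a b) (bmeet A c d)"
proof -
  have "bmeet A (bmeet A a b) (bmeet A c d) = bmeet A (bmeet A a c) (bmeet A b d)"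
    using assms(1-4) by (metis meet_assoc meet_closed meet_commute)
  then show ?thesis using assms(5,6) by (simp add: ble_def)
qed

lemma ble_meetI:
  assumes "a \<in> carrier A" "b \<in> carrier A" "c \<in> carrier A" "ble A a b" "ble A a c"
  shows "ble A a (bmeet A b c)"
  using meet_mono[OF assms(1,1,2,3,4,5)] assms(1) by (simp add: meet_idem)

lemma split_by: "m \<in> carrier A \<Longrightarrow> a \<in> carrier A \<Longrightarrow>
    bjoin A (bmeet A m a) (bmeet A m (bneg A a)) = m"
  by (metis join_neg meet_join_distrib meet_top neg_closed)

section \<open>Filters and their maximal extensions\<close>

definition bfilter :: "'a set \<Rightarrow> bool" where
  "bfilter M \<longleftrightarrow> M \<subseteq> carrier A \<and> (\<forall>a\<in>M. \<forall>b\<in>M. bmeet A a b \<in> M) \<and>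
     (\<forall>a\<in>M. \<forall>b\<in>carrier A. ble A a b \<longrightarrow> b \<in> M)"

lemma bfilter_principal: "a \<in> carrier A \<Longrightarrow> bfilter {c \<in> carrier A. ble A a c}"
  unfolding bfilter_def by (auto intro: ble_trans ble_meetI meet_closed)

text \<open>For nonempty \<open>M\<close> this is the filter generated by \<open>M\<close> and
  \<open>a\<close>; witnesses \<open>m\<close> and \<open>n\<close> combine to the witness
  \<open>bmeet A m n\<close>.\<close>

lemma bfilter_adjoin:
  assumes M: "bfilter M" and a: "a \<in> carrier A"
  shows "bfilter {c \<in> carrier A. \<exists>m\<in>M. ble A (bmeet A m a) c}"
proof -
  have M': "M \<subseteq> carrier A" "\<And>a b. a \<in> M \<Longrightarrow> b \<in> M \<Longrightarrow> bmeet A a b \<in> M"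
    using M by (auto simp: bfilter_def)
  have "\<exists>k\<in>M. ble A (bmeet A k a) (bmeet A c d)"
    if "c \<in> carrier A" "d \<in> carrier A" "m \<in> M" "n \<in> M" "ble A (bmeet A m a) c" "ble A (bmeet A n a) d"
    for c d m n
  proof
    have mn: "m \<in> carrier A" "n \<in> carrier A" using that M' by auto
    let ?k = "bmeet A m n"
    have "ble A (bmeet A ?k a) (bmeet A m a)" "ble A (bmeet A ?k a) (bmeet A n a)"
      using mn a by (auto intro!: meet_mono meet_ble1 meet_ble2 ble_refl meet_closed)
    then have "ble A (bmeet A ?k a) c" "ble A (bmeet A ?k a) d"
      using that mn a by (meson ble_trans meet_closed)+
    then show "ble A (bmeet A ?k a) (bmeet A c d)"
      using that mn a by (meson ble_meetI meet_closed)
    show "?k \<in> M" using that M' by auto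
  qed
  moreover have "\<exists>m\<in>M. ble A (bmeet A m a) d"
    if "c \<in> carrier A" "d \<in> carrier A" "m \<in> M" "ble A (bmeet A m a) c" "ble A c d" for c d m
    using that M' a by (meson ble_trans meet_closed subsetD)
  ultimately show ?thesis
    unfolding bfilter_def by (simp add: subset_iff meet_closed) blast
qed

text \<open>Any two elements of the union already lie in a common member of the chain.\<close>

lemma bfilter_Union_chain:
  assumes "subset.chain {M. bfilter M} \<C>"
  shows "bfilter (\<Union>\<C>)"
proof -
  have "bmeet A a b \<in> \<Union>\<C>" if "a \<in> M" "b \<in> N" "M \<in> \<C>" "N \<in> \<C>" for a b M N
  proof -
    have "M \<subseteq> N \<or> N \<subseteq> M" "bfilter M" "bfilter N"
      using assms that by (auto simp: subset.chain_def)
    then show ?thesis using that unfolding bfilter_def by blast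
  qed
  moreover have fM: "\<And>M. M \<in> \<C> \<Longrightarrow> bfilter M" using assms by (auto simp: subset.chain_def)
  moreover have "b \<in> \<Union>\<C>" if "a \<in> M" "M \<in> \<C>" "b \<in> carrier A" "ble A a b" for a b M
    using fM[OF that(2)] that unfolding bfilter_def by blast
  moreover have "\<Union>\<C> \<subseteq> carrier A" using fM unfolding bfilter_def by blast
  ultimately show ?thesis unfolding bfilter_def[of "\<Union>\<C>"] by (meson UnionE)
qed

text \<open>A filter that is maximal inside a join-prime up-set is an ultrafilter. The up-set of all
  \<open>c\<close> with \<open>\<diamond>c \<in> F\<close> yields the successors of \<open>F\<close>; that of all \<open>c \<noteq> 0\<close> separates points.\<close>

lemma ex_ultrafilter:
  assumes T: "T \<subseteq> carrier A" "bbot A \<notin> T"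
    and up: "\<And>a b. a \<in> T \<Longrightarrow> b \<in> carrier A \<Longrightarrow> ble A a b \<Longrightarrow> b \<in> T"
    and prime: "\<And>a b. a \<in> carrier A \<Longrightarrow> b \<in> carrier A \<Longrightarrow> bjoin A a b \<in> T \<Longrightarrow> a \<in> T \<or> b \<in> T"
    and x: "x \<in> T"
  obtains G where "ultrafilter A G" "x \<in> G" "G \<subseteq> T"
proof -
  \<comment> \<open>\<open>bfilter\<close> demands neither nonemptiness nor properness: here they
    come from \<open>x\<close> and from \<open>T\<close> omitting \<open>bbot A\<close>.\<close>
  define \<A> where "\<A> = {M. bfilter M \<and> x \<in> M \<and> M \<subseteq> T}"
  have xc: "x \<in> carrier A" using x T by auto
  have "{c \<in> carrier A. ble A x c} \<in> \<A>"
    using x xc up by (auto simp: \<A>_def bfilter_principal ble_refl)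
  moreover have "\<Union>\<C> \<in> \<A>" if "\<C> \<noteq> {}" "subset.chain \<A> \<C>" for \<C>
    using that bfilter_Union_chain[of \<C>] unfolding \<A>_def subset.chain_def by blast
  ultimately obtain M where M: "M \<in> \<A>" and max: "\<And>N. N \<in> \<A> \<Longrightarrow> M \<subseteq> N \<Longrightarrow> N = M"
    using subset_Zorn_nonempty[of \<A>] by blast
  have fM: "bfilter M" "x \<in> M" "M \<subseteq> T" using M by (auto simp: \<A>_def)
  have Mc: "M \<subseteq> carrier A" using fM T by auto
  \<comment> \<open>Otherwise adjoining \<open>a\<close> to \<open>M\<close> yields a larger filter
    still inside the up-set \<open>T\<close>, against maximality.\<close>
  have outside: "\<exists>m\<in>M. bmeet A m a \<notin> T" if a: "a \<in> carrier A" "a \<notin> M" for a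
  proof (rule ccontr)
    assume "\<not> ?thesis"
    then have *: "\<And>m. m \<in> M \<Longrightarrow> bmeet A m a \<in> T" by auto
    let ?N = "{c \<in> carrier A. \<exists>m\<in>M. ble A (bmeet A m a) c}"
    have sub: "M \<subseteq> ?N" using Mc a by (auto intro: meet_ble1)
    have "?N \<in> \<A>"
      using bfilter_adjoin[OF fM(1) a(1)] sub fM(2) * up unfolding \<A>_def by blast
    then have "?N = M" using max sub by blast
    moreover have "a \<in> ?N" using fM(2) xc a meet_ble2 by blast
    ultimately show False using a by blast
  qed
  \<comment> \<open>If both are missing, some \<open>k\<close> in \<open>M\<close> has its meets
    with \<open>a\<close> and with \<open>bneg A a\<close> outside \<open>T\<close>; primeness
    expels their join, which is \<open>k\<close>.\<close>
  have "a \<in> M \<or> bneg A a \<in> M" if a: "a \<in> carrier A" for a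
  proof (rule ccontr)
    assume neither: "\<not> ?thesis"
    obtain m where m: "m \<in> M" "bmeet A m a \<notin> T" using outside a neither by blast
    obtain n where n: "n \<in> M" "bmeet A n (bneg A a) \<notin> T"
      using outside a neither neg_closed by blast
    define k where "k = bmeet A m n"
    have k: "k \<in> M" "k \<in> carrier A" using m n fM Mc by (auto simp: k_def bfilter_def)
    have c: "m \<in> carrier A" "n \<in> carrier A" "bneg A a \<in> carrier A" using m n Mc a neg_closed by auto
    have "ble A (bmeet A k a) (bmeet A m a)" "ble A (bmeet A k (bneg A a)) (bmeet A n (bneg A a))"
      unfolding k_def using c a
      by (auto intro!: meet_mono meet_ble1 meet_ble2 ble_refl meet_closed)
    then have "bmeet A k a \<notin> T" "bmeet A k (bneg A a) \<notin> T"
      using m n up c a meet_closed by blast+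
    then have "k \<notin> T" using prime[of "bmeet A k a" "bmeet A k (bneg A a)"] k c a
      by (auto simp: split_by meet_closed)
    then show False using k fM by auto
  qed
  moreover have "btop A \<in> M"
    using fM xc unfolding bfilter_def by (metis ble_def meet_top top_closed)
  ultimately have "ultrafilter A M"
    using fM T(2) Mc unfolding ultrafilter_def bfilter_def by blast
  then show thesis using that fM by blast
qed

section \<open>Ultrafilters as points that decide every element\<close>

lemma uf_top: "ultrafilter A F \<Longrightarrow> btop A \<in> F"
  by (simp add: ultrafilter_def)

lemma uf_bot: "ultrafilter A F \<Longrightarrow> bbot A \<notin> F"
  by (simp add: ultrafilter_def)

lemma uf_carrier: "ultrafilter A F \<Longrightarrow> a \<in> F \<Longrightarrow> a \<in> carrier A"
  by (auto simp: ultrafilter_def)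

lemma uf_up: "ultrafilter A F \<Longrightarrow> a \<in> F \<Longrightarrow> b \<in> carrier A \<Longrightarrow> ble A a b \<Longrightarrow> b \<in> F"
  by (auto simp: ultrafilter_def)

lemma uf_meet: "ultrafilter A F \<Longrightarrow> a \<in> carrier A \<Longrightarrow> b \<in> carrier A \<Longrightarrow>
    bmeet A a b \<in> F \<longleftrightarrow> a \<in> F \<and> b \<in> F"
  by (meson meet_ble1 meet_ble2 ultrafilter_def)

lemma uf_neg: "ultrafilter A F \<Longrightarrow> a \<in> carrier A \<Longrightarrow> bneg A a \<in> F \<longleftrightarrow> a \<notin> F"
  by (metis meet_neg ultrafilter_def)

lemma uf_join:
  assumes F: "ultrafilter A F" and a: "a \<in> carrier A" and b: "b \<in> carrier A"
  shows "bjoin A a b \<in> F \<longleftrightarrow> a \<in> F \<or> b \<in> F"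
proof
  assume "bjoin A a b \<in> F"
  show "a \<in> F \<or> b \<in> F"
  proof (rule ccontr)
    assume "\<not> (a \<in> F \<or> b \<in> F)"
    then have "bneg A a \<in> F" "bneg A b \<in> F" using uf_neg F a b by auto
    then have "bmeet A (bneg A a) (bjoin A a b) \<in> F" using \<open>bjoin A a b \<in> F\<close> F
      by (simp add: ultrafilter_def)
    moreover have "bmeet A (bneg A a) (bjoin A a b) = bmeet A (bneg A a) b"
      using a b by (metis join_bot join_commute meet_closed meet_commute meet_join_distrib meet_neg
          neg_closed bot_closed)
    ultimately have "b \<in> F" using uf_meet[OF F] a b neg_closed by simp
    then show False using \<open>\<not> (a \<in> F \<or> b \<in> F)\<close> by blast
  qed
next
  assume "a \<in> F \<or> b \<in> F"
  then show "bjoin A a b \<in> F"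
    using uf_up[OF F] a b by (meson ble_join1 ble_join2 join_closed)
qed

lemmas uf_simps = uf_top uf_bot uf_meet uf_neg uf_join meet_closed join_closed neg_closed bot_closed
  top_closed

lemma ultrafilter_through:
  assumes x: "x \<in> carrier A" "x \<noteq> bbot A"
  obtains G where "ultrafilter A G" "x \<in> G"
proof (rule ex_ultrafilter[of "carrier A - {bbot A}" x])
  show "b \<in> carrier A - {bbot A}"
    if "a \<in> carrier A - {bbot A}" "b \<in> carrier A" "ble A a b" for a b
    using that by (auto simp: ble_def meet_bot)
  show "a \<in> carrier A - {bbot A} \<or> b \<in> carrier A - {bbot A}"
    if "a \<in> carrier A" "b \<in> carrier A" "bjoin A a b \<in> carrier A - {bbot A}" for a b
    using that join_bot bot_closed by auto
qed (use x that in auto)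

text \<open>If \<open>a\<close> is not below \<open>b\<close>, an ultrafilter through
  \<open>bmeet A a (bneg A b)\<close> separates them. Inequalities can thus be checked point by
  point.\<close>

lemma ble_iff_uf:
  assumes a: "a \<in> carrier A" and b: "b \<in> carrier A"
  shows "ble A a b \<longleftrightarrow> (\<forall>F. ultrafilter A F \<longrightarrow> a \<in> F \<longrightarrow> b \<in> F)"
proof
  assume R: "\<forall>F. ultrafilter A F \<longrightarrow> a \<in> F \<longrightarrow> b \<in> F"
  have c: "bmeet A a (bneg A b) \<in> carrier A" using a b by (simp add: meet_closed neg_closed)
  have "bmeet A a (bneg A b) = bbot A"
  proof (rule ccontr)
    assume "bmeet A a (bneg A b) \<noteq> bbot A"
    then obtain G where "ultrafilter A G" "bmeet A a (bneg A b) \<in> G"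
      using ultrafilter_through c by metis
    moreover have "a \<in> G" "b \<notin> G" using calculation a b by (auto simp: uf_simps)
    ultimately show False using R by blast
  qed
  then show "ble A a b" using split_by[OF a b] a b
    unfolding ble_def by (simp add: join_bot meet_closed)
qed (use a b uf_up in blast)

lemma eq_iff_uf:
  assumes a: "a \<in> carrier A" and b: "b \<in> carrier A"
  shows "a = b \<longleftrightarrow> (\<forall>F. ultrafilter A F \<longrightarrow> a \<in> F \<longleftrightarrow> b \<in> F)"
  using ble_iff_uf[OF a b] ble_iff_uf[OF b a] a b unfolding ble_def by (metis meet_commute)

end

section \<open>Successors under an S4 operator\<close>

locale bool_algebra_with_s4 = bool_algebra A + s4_operator A f
  for A :: "('a, 'z) bool_alg_scheme" and f
begin

text \<open>On ultrafilters this is \<open>dual_rel\<close> when \<open>f\<close> is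
  \<open>dia A\<close>; keeping \<open>f\<close> abstract also covers the relation of
  \<open>exs A\<close>.\<close>

definition acc :: "'a set \<Rightarrow> 'a set \<Rightarrow> bool" where
  "acc F G \<longleftrightarrow> ultrafilter A F \<and> ultrafilter A G \<and> (\<forall>a\<in>G. f a \<in> F)"

text \<open>This is \<box> when \<open>f\<close> is \<open>dia A\<close>, and \<forall> when
  \<open>f\<close> is \<open>exs A\<close>.\<close>

definition dual_op :: "'a \<Rightarrow> 'a" where
  "dual_op a = bneg A (f (bneg A a))"

lemma dual_op_closed: "a \<in> carrier A \<Longrightarrow> dual_op a \<in> carrier A"
  by (simp add: dual_op_def neg_closed op_closed)

lemma op_mono:
  assumes "a \<in> carrier A" "b \<in> carrier A" "ble A a b"
  shows "ble A (f a) (f b)"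
proof -
  have "bjoin A a b = b"
    by (subst eq_iff_uf) (use assms uf_up in \<open>auto simp: uf_simps\<close>)
  then show ?thesis using assms by (metis ble_join1 op_closed op_join)
qed

text \<open>The Jonsson-Tarski existence lemma: the elements that \<open>f\<close> sends into
  \<open>F\<close> form an up-set by monotonicity, are join-prime by additivity and omit the bottom,
  so an ultrafilter through \<open>a\<close> fits among them.\<close>

lemma uf_op:
  assumes F: "ultrafilter A F" and a: "a \<in> carrier A"
  shows "f a \<in> F \<longleftrightarrow> (\<exists>G. acc F G \<and> a \<in> G)"
proof
  assume "f a \<in> F"
  let ?T = "{c \<in> carrier A. f c \<in> F}"
  obtain G where "ultrafilter A G" "a \<in> G" "G \<subseteq> ?T"
  proof (rule ex_ultrafilter[of ?T a])
    show "y \<in> ?T" if "x \<in> ?T" "y \<in> carrier A" "ble A x y" for x y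
      using that op_mono uf_up[OF F] op_closed by auto
    show "x \<in> ?T \<or> y \<in> ?T" if "x \<in> carrier A" "y \<in> carrier A" "bjoin A x y \<in> ?T" for x y
      using that uf_join[OF F] by (simp add: op_join op_closed)
  qed (use F a \<open>f a \<in> F\<close> in \<open>auto simp: op_bot uf_bot\<close>)
  then show "\<exists>G. acc F G \<and> a \<in> G" using F unfolding acc_def by blast
qed (auto simp: acc_def)

lemma uf_dual_op:
  assumes F: "ultrafilter A F" and a: "a \<in> carrier A"
  shows "dual_op a \<in> F \<longleftrightarrow> (\<forall>G. acc F G \<longrightarrow> a \<in> G)"
proof -
  have "dual_op a \<in> F \<longleftrightarrow> \<not> (\<exists>G. acc F G \<and> bneg A a \<in> G)"
    using F a by (simp add: dual_op_def uf_neg uf_op op_closed neg_closed)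
  also have "\<dots> \<longleftrightarrow> (\<forall>G. acc F G \<longrightarrow> a \<in> G)"
    using a uf_neg unfolding acc_def by blast
  finally show ?thesis .
qed

lemma acc_refl: "ultrafilter A F \<Longrightarrow> acc F F"
  unfolding acc_def using uf_up op_increasing op_closed uf_carrier by blast

lemma acc_trans: "acc F G \<Longrightarrow> acc G H \<Longrightarrow> acc F H"
  unfolding acc_def using uf_up op_transitive op_closed uf_carrier by metis

lemma acc_uf: "acc F G \<Longrightarrow> ultrafilter A F" "acc F G \<Longrightarrow> ultrafilter A G"
  by (simp_all add: acc_def)

text \<open>By transitivity every successor of \<open>G\<close> is a successor of
  \<open>F\<close>.\<close>

lemma dual_op_acc:
  assumes "acc F G" "a \<in> carrier A" "dual_op a \<in> F"
  shows "dual_op a \<in> G"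
  using assms uf_dual_op[OF acc_uf(1)[OF assms(1)]] uf_dual_op[OF acc_uf(2)[OF assms(1)]]
    acc_trans[OF assms(1)] by blast

end

sublocale s4_algebra \<subseteq> bool_algebra_with_s4 A "dia A"
  by unfold_locales

section \<open>Depth of S4-algebras\<close>

text \<open>The value of \<open>P_form n\<close>, defined without \<open>exs\<close> so that it also
  applies to the fixpoint algebra. Starting from the bottom, one recursion covers index 1 as well,
  since the meet with \<not>0 = 1 changes nothing.\<close>

primrec P_val :: "('a, 'z) s4_alg_scheme \<Rightarrow> (nat \<Rightarrow> 'a) \<Rightarrow> nat \<Rightarrow> 'a" where
  "P_val A v 0 = bbot A"
| "P_val A v (Suc n) =
     (let b = bneg A (dia A (bneg A (v (Suc n))))
      in bjoin A (bneg A (dia A (bmeet A b (bneg A (P_val A v n))))) b)"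

lemma P_val_cong: "(\<And>i. i \<le> n \<Longrightarrow> v i = w i) \<Longrightarrow> P_val A v n = P_val A w n"
  by (induction n) (auto simp: Let_def)

context s4_algebra
begin

lemma P_val_Suc: "P_val A v (Suc n) =
    bjoin A (bneg A (dia A (bmeet A (dual_op (v (Suc n))) (bneg A (P_val A v n))))) (dual_op (v (Suc n)))"
  by (simp add: dual_op_def Let_def)

lemma P_val_closed: "range v \<subseteq> carrier A \<Longrightarrow> P_val A v n \<in> carrier A"
proof (induction n)
  case (Suc n)
  then have "v (Suc n) \<in> carrier A" by auto
  with Suc show ?case unfolding P_val_Suc
    by (simp add: join_closed meet_closed neg_closed op_closed dual_op_closed)
qed (simp add: bot_closed)

text \<open>The Kripke truth clause of the implication: the successor that \<diamond> asks for in
  the antecedent becomes a universally quantified \<open>G\<close>.\<close>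

lemma uf_P_val_Suc:
  assumes F: "ultrafilter A F" and v: "range v \<subseteq> carrier A"
  shows "P_val A v (Suc n) \<in> F \<longleftrightarrow>
    (\<forall>G. acc F G \<longrightarrow> dual_op (v (Suc n)) \<in> G \<longrightarrow> P_val A v n \<notin> G \<longrightarrow> dual_op (v (Suc n)) \<in> F)"
proof -
  have vc: "v (Suc n) \<in> carrier A" using v by auto
  have "\<And>G. acc F G \<Longrightarrow> bmeet A (dual_op (v (Suc n))) (bneg A (P_val A v n)) \<in> G \<longleftrightarrow>
      dual_op (v (Suc n)) \<in> G \<and> P_val A v n \<notin> G"
    using vc P_val_closed[OF v] by (simp add: acc_def uf_simps dual_op_closed)
  then show ?thesis unfolding P_val_Suc using vc F P_val_closed[OF v]
    by (auto simp: uf_simps dual_op_closed op_closed uf_op)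
qed

section \<open>Refutations of \<open>P_val\<close> and proper chains\<close>

lemma proper_chain_Cons:
  "proper_chain A (F # G # Fs) \<longleftrightarrow> acc F G \<and> \<not> acc G F \<and> proper_chain A (G # Fs)"
  unfolding proper_chain_def acc_def dual_rel_def by auto

text \<open>A refutation at \<open>F\<close> provides a successor \<open>G\<close> with \<box>q that
  refutes the previous formula. \<open>G\<close> cannot see \<open>F\<close>, because \<box>q would
  persist to \<open>F\<close>, where it fails.\<close>

lemma chain_of_P_val:
  assumes "range v \<subseteq> carrier A" "ultrafilter A F" "P_val A v n \<notin> F"
  shows "\<exists>Fs. proper_chain A (F # Fs) \<and> length Fs = n"
  using assms(2,3)
proof (induction n arbitrary: F)
  case 0
  then show ?case by (auto simp: proper_chain_def)
next
  case (Suc n)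
  let ?b = "dual_op (v (Suc n))"
  have vc: "v (Suc n) \<in> carrier A" using assms by auto
  obtain G where G: "acc F G" "?b \<in> G" "P_val A v n \<notin> G" "?b \<notin> F"
    using Suc.prems uf_P_val_Suc assms by blast
  have "\<not> acc G F"
    using G vc acc_trans uf_dual_op unfolding acc_def[of F G] by blast
  moreover obtain Fs where "proper_chain A (G # Fs)" "length Fs = n"
    using Suc.IH[of G] G by (auto simp: acc_def)
  ultimately have "proper_chain A (F # G # Fs)" "length (G # Fs) = Suc n"
    using G by (auto simp: proper_chain_Cons)
  then show ?case by blast
qed

text \<open>The valuation is built from the far end of the chain, each new variable separating two
  neighbouring points.\<close>

lemma P_val_of_chain:
  assumes "proper_chain A (F # Fs)" "length Fs = n"
  shows "\<exists>v. range v \<subseteq> carrier A \<and> P_val A v n \<notin> F"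
  using assms
proof (induction n arbitrary: F Fs)
  case 0
  then show ?case
    by (intro exI[of _ "\<lambda>_. bbot A"]) (auto simp: proper_chain_def uf_bot bot_closed)
next
  case (Suc n)
  then obtain G Gs where Fs: "Fs = G # Gs" by (cases Fs) auto
  with Suc have FG: "acc F G" "\<not> acc G F" "proper_chain A (G # Gs)" "length Gs = n"
    by (auto simp: proper_chain_Cons)
  then have uf: "ultrafilter A F" "ultrafilter A G" by (auto simp: acc_def)
  obtain v where v: "range v \<subseteq> carrier A" "P_val A v n \<notin> G" using Suc.IH FG by blast
  \<comment> \<open>Since \<open>G\<close> does not see \<open>F\<close>, some \<open>a\<close> in
    \<open>F\<close> has \<diamond>a outside \<open>G\<close>; its complement \<open>q\<close> then
    satisfies \<box>q at \<open>G\<close> but fails at \<open>F\<close>.\<close>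
  obtain a where a: "a \<in> F" "dia A a \<notin> G" using FG uf unfolding acc_def by blast
  then have ac: "a \<in> carrier A" using uf uf_carrier by blast
  define q where "q = bneg A a"
  have q: "q \<in> carrier A" "q \<notin> F" using ac a uf by (auto simp: q_def uf_simps)
  have "dual_op q \<in> G"
    using a ac uf unfolding q_def by (metis acc_def neg_closed uf_dual_op uf_neg)
  moreover have "dual_op q \<notin> F" using uf_dual_op q uf acc_refl by blast
  \<comment> \<open>Only index \<open>Suc n\<close> changes, so the value refuted at
    \<open>G\<close> stays the same.\<close>
  moreover define w where "w = v(Suc n := q)"
  moreover have "P_val A w n = P_val A v n" by (rule P_val_cong) (simp add: w_def)
  moreover have w: "range w \<subseteq> carrier A" using v q by (auto simp: w_def)
  ultimately have "P_val A w (Suc n) \<notin> F"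
    using uf_P_val_Suc[OF uf(1) w, of n] FG v by auto
  with w show ?case by blast
qed

lemma proper_chain_take: "proper_chain A Fs \<Longrightarrow> proper_chain A (take k Fs)"
  unfolding proper_chain_def successively_conv_nth
  by (auto dest: in_set_takeD)

text \<open>A point refuting index \<open>n\<close> is the start of a proper chain with
  \<open>n + 1\<close> points, and conversely.\<close>

lemma depth_le_iff:
  "depth A \<le> enat n \<longleftrightarrow> (\<forall>v. range v \<subseteq> carrier A \<longrightarrow> P_val A v n = btop A)"
proof
  assume d: "depth A \<le> enat n"
  show "\<forall>v. range v \<subseteq> carrier A \<longrightarrow> P_val A v n = btop A"
  proof (intro allI impI)
    fix v :: "nat \<Rightarrow> 'a" assume v: "range v \<subseteq> carrier A"
    have "P_val A v n \<in> F" if F: "ultrafilter A F" for F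
    proof (rule ccontr)
      assume "P_val A v n \<notin> F"
      then obtain Fs where Fs: "proper_chain A (F # Fs)" "length Fs = n"
        using chain_of_P_val v F by blast
      then have "enat (length (F # Fs)) \<le> depth A"
        unfolding depth_def by (intro Sup_upper) blast
      with d Fs show False by (metis Suc_n_not_le_n enat_ord_simps(1) length_Cons order_trans)
    qed
    then show "P_val A v n = btop A"
      by (subst eq_iff_uf) (auto simp: P_val_closed v top_closed uf_top)
  qed
next
  assume P: "\<forall>v. range v \<subseteq> carrier A \<longrightarrow> P_val A v n = btop A"
  have "length Fs \<le> n" if Fs: "proper_chain A Fs" for Fs
  proof (rule ccontr)
    assume "\<not> length Fs \<le> n"
    \<comment> \<open>A longer chain is cut to exactly \<open>n + 1\<close> points, the length that
      matches index \<open>n\<close>.\<close>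
    then have len: "length (take (Suc n) Fs) = Suc n" by simp
    then obtain F Gs where FG: "take (Suc n) Fs = F # Gs" "length Gs = n"
      by (metis length_Suc_conv)
    then have chain: "proper_chain A (F # Gs)" using proper_chain_take[OF Fs, of "Suc n"] by simp
    then have "ultrafilter A F" by (simp add: proper_chain_def)
    then show False using P_val_of_chain[OF chain FG(2)] P uf_top by metis
  qed
  then show "depth A \<le> enat n" unfolding depth_def by (auto intro!: Sup_least)
qed

end

section \<open>Fixpoints of the existential quantifier\<close>

context ms4_algebra
begin

sublocale s4_algebra A
  by unfold_locales

sublocale ex: bool_algebra_with_s4 A "exs A"
  by unfold_locales

text \<open>For \<open>a\<close> in \<open>F\<close> the axiom a \<le> \<forall>\<exists>a puts
  \<forall>\<exists>a into \<open>F\<close>, hence \<exists>a into the successor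
  \<open>G\<close>.\<close>

lemma ex_acc_sym:
  assumes "ex.acc F G"
  shows "ex.acc G F"
  unfolding ex.acc_def
proof (intro conjI ballI)
  show uf: "ultrafilter A G" "ultrafilter A F" using assms by (auto simp: ex.acc_def)
  fix a assume a: "a \<in> F"
  then have ac: "a \<in> carrier A" using uf uf_carrier by blast
  then have "ex.dual_op (exs A a) \<in> F"
    using uf_up[OF uf(2) a] exs.op_symmetric ex.dual_op_closed exs.op_closed
    by (simp add: ex.dual_op_def)
  then show "exs A a \<in> G" using assms uf ac ex.uf_dual_op exs.op_closed by blast
qed

text \<open>On points \<exists> takes preimages under \<open>ex.acc\<close>. As this relation is an
  equivalence, fixpoints correspond to unions of its classes.\<close>

lemma ex_fixpoint_iff:
  assumes a: "a \<in> carrier A"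
  shows "exs A a = a \<longleftrightarrow> (\<forall>F G. ex.acc F G \<longrightarrow> a \<in> G \<longrightarrow> a \<in> F)"
proof
  assume "exs A a = a"
  then show "\<forall>F G. ex.acc F G \<longrightarrow> a \<in> G \<longrightarrow> a \<in> F" by (metis ex.acc_def)
next
  assume R: "\<forall>F G. ex.acc F G \<longrightarrow> a \<in> G \<longrightarrow> a \<in> F"
  have "exs A a \<in> F \<longleftrightarrow> a \<in> F" if F: "ultrafilter A F" for F
    using ex.uf_op[OF F a] R ex.acc_refl[OF F] by blast
  then show "exs A a = a" by (subst eq_iff_uf) (auto simp: a exs.op_closed)
qed

definition fixpoints :: "'a set" where
  "fixpoints = {a \<in> carrier A. exs A a = a}"

lemma fixpoints_iff:
  "a \<in> fixpoints \<longleftrightarrow> a \<in> carrier A \<and> (\<forall>F G. ex.acc F G \<longrightarrow> a \<in> G \<longrightarrow> a \<in> F)"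
  unfolding fixpoints_def using ex_fixpoint_iff by blast

lemma fixpoints_carrier: "a \<in> fixpoints \<Longrightarrow> a \<in> carrier A"
  by (simp add: fixpoints_def)

lemma fixpoints_bot: "bbot A \<in> fixpoints"
  by (simp add: fixpoints_def bot_closed exs.op_bot)

lemma fixpoints_join: "a \<in> fixpoints \<Longrightarrow> b \<in> fixpoints \<Longrightarrow> bjoin A a b \<in> fixpoints"
  by (simp add: fixpoints_def join_closed exs.op_join)

text \<open>Complementation reverses the direction in which membership is transported; symmetry of
  \<open>ex.acc\<close> restores it.\<close>

lemma fixpoints_neg:
  assumes "a \<in> fixpoints"
  shows "bneg A a \<in> fixpoints"
proof -
  have "bneg A a \<in> F" if "ex.acc F G" "bneg A a \<in> G" for F G
  proof -
    have "ultrafilter A F" "ultrafilter A G" using that by (auto simp: ex.acc_def)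
    then show ?thesis using assms that ex_acc_sym by (auto simp: fixpoints_iff uf_neg)
  qed
  then show ?thesis using assms by (auto simp: fixpoints_iff neg_closed)
qed

lemma fixpoints_meet:
  assumes "a \<in> fixpoints" "b \<in> fixpoints"
  shows "bmeet A a b \<in> fixpoints"
proof -
  have "bmeet A a b \<in> F" if "ex.acc F G" "bmeet A a b \<in> G" for F G
  proof -
    have "ultrafilter A F" "ultrafilter A G" using that by (auto simp: ex.acc_def)
    then show ?thesis using assms that by (auto simp: fixpoints_iff uf_meet)
  qed
  then show ?thesis using assms by (auto simp: fixpoints_iff meet_closed)
qed

lemma fixpoints_top: "btop A \<in> fixpoints"
  by (simp add: fixpoints_iff top_closed ex.acc_def uf_top)

text \<open>The mixed axiom gives \<exists>\<diamond>a \<le> \<diamond>\<exists>a = \<diamond>a, and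
  \<exists> is increasing.\<close>

lemma fixpoints_dia:
  assumes "a \<in> fixpoints"
  shows "dia A a \<in> fixpoints"
proof -
  have a: "a \<in> carrier A" "exs A a = a" using assms by (auto simp: fixpoints_def)
  have "ble A (exs A (dia A a)) (dia A a)" using ex_dia_le[OF a(1)] a by simp
  moreover have "ble A (dia A a) (exs A (dia A a))" using a exs.op_increasing dia.op_closed by simp
  ultimately have "exs A (dia A a) = dia A a"
    unfolding ble_def using a by (metis exs.op_closed meet_commute dia.op_closed)
  then show ?thesis using a by (simp add: fixpoints_def dia.op_closed)
qed

lemma fixpoints_forall:
  assumes "a \<in> carrier A"
  shows "ex.dual_op a \<in> fixpoints"
proof -
  have "ex.dual_op a \<in> F" if "ex.acc F G" "ex.dual_op a \<in> G" for F G
    using ex.dual_op_acc[OF ex_acc_sym[OF that(1)] assms that(2)] .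
  then show ?thesis using assms by (auto simp: fixpoints_iff ex.dual_op_closed)
qed

lemma forall_fixpoint:
  assumes "a \<in> fixpoints"
  shows "ex.dual_op a = a"
  using fixpoints_neg[OF assms] assms unfolding ex.dual_op_def fixpoints_def
  by (auto intro!: iffD2[OF eq_iff_uf] simp: uf_simps)

lemma fixpoints_box: "a \<in> fixpoints \<Longrightarrow> dual_op a \<in> fixpoints"
  by (simp add: dual_op_def fixpoints_neg fixpoints_dia)

text \<open>All laws are inherited from \<open>A\<close>; only closure under the operations has
  content.\<close>

lemma s4_fixpoint_algebra: "s4_algebra (fixpoint_algebra A)"
proof -
  have carr: "carrier (fixpoint_algebra A) = fixpoints"
    by (simp add: fixpoint_algebra_def fixpoints_def)
  have sel: "bmeet (fixpoint_algebra A) = bmeet A" "bjoin (fixpoint_algebra A) = bjoin A"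
    "bneg (fixpoint_algebra A) = bneg A" "bbot (fixpoint_algebra A) = bbot A"
    "btop (fixpoint_algebra A) = btop A" "dia (fixpoint_algebra A) = dia A"
    by (simp_all add: fixpoint_algebra_def)
  have le: "ble (fixpoint_algebra A) = ble A" by (intro ext) (simp add: ble_def sel)
  show ?thesis
  proof
    fix a b c
    assume abc: "a \<in> carrier (fixpoint_algebra A)" "b \<in> carrier (fixpoint_algebra A)"
      "c \<in> carrier (fixpoint_algebra A)"
    then have c: "a \<in> carrier A" "b \<in> carrier A" "c \<in> carrier A"
      using carr fixpoints_carrier by auto
    show "bmeet (fixpoint_algebra A) a (bjoin (fixpoint_algebra A) b c) =
        bjoin (fixpoint_algebra A) (bmeet (fixpoint_algebra A) a b) (bmeet (fixpoint_algebra A) a c)"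
      using c by (simp add: sel meet_join_distrib)
    show "bjoin (fixpoint_algebra A) a (bmeet (fixpoint_algebra A) b c) =
        bmeet (fixpoint_algebra A) (bjoin (fixpoint_algebra A) a b) (bjoin (fixpoint_algebra A) a c)"
      using c by (simp add: sel join_meet_distrib)
  qed (auto simp: carr sel le fixpoints_carrier fixpoints_bot fixpoints_top
      intro: fixpoints_meet fixpoints_join fixpoints_neg fixpoints_dia meet_assoc meet_commute
        join_assoc join_commute meet_top join_bot meet_neg join_neg dia.op_bot dia.op_join dia.op_increasing
        dia.op_transitive fixpoints_carrier)
qed

lemma P_val_fixpoint_algebra: "P_val (fixpoint_algebra A) v n = P_val A v n"
  by (induction n) (simp_all add: fixpoint_algebra_def Let_def)

lemma P_val_fixpoint: "range v \<subseteq> fixpoints \<Longrightarrow> P_val A v n \<in> fixpoints"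
proof (induction n)
  case (Suc n)
  then have "v (Suc n) \<in> fixpoints" by auto
  with Suc show ?case unfolding P_val_Suc
    by (simp add: fixpoints_join fixpoints_meet fixpoints_neg fixpoints_dia fixpoints_box)
qed (simp add: fixpoints_bot)

section \<open>Evaluation of the depth formulas\<close>

lemma neg_bot: "bneg A (bbot A) = btop A"
  by (metis bot_closed join_bot join_commute join_neg neg_closed)

lemma eval_P_form:
  assumes "range v \<subseteq> carrier A"
  shows "eval A v (P_form n) = P_val A v n"
proof (induction n rule: P_form.induct)
  \<comment> \<open>Here the formula lacks the conjunct with the previous formula, which in
    \<open>P_val\<close> is the top element.\<close>
  case 2
  have "v (Suc 0) \<in> carrier A" using assms by auto
  then show ?case by (simp add: Let_def neg_bot meet_top neg_closed dia.op_closed)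
qed (auto simp: Let_def)

lemma eval_P0_form:
  assumes "range v \<subseteq> carrier A"
  shows "eval A v (P0_form n) = P_val A (\<lambda>i. ex.dual_op (v i)) n"
proof -
  let ?w = "\<lambda>i. ex.dual_op (v i)"
  have w: "?w i \<in> fixpoints" for i using assms fixpoints_forall by auto
  then have box: "dual_op (?w i) \<in> fixpoints" for i using fixpoints_box by simp
  have P: "P_val A ?w m \<in> fixpoints" for m using P_val_fixpoint[of ?w m] w by blast
  have ex: "a \<in> fixpoints \<Longrightarrow> exs A a = a" for a by (simp add: fixpoints_def)
  show ?thesis
  proof (induction n rule: P0_form.induct)
    case 2
    show ?case using box[of 1]
      by (simp add: Let_def neg_bot meet_top ex dual_op_def ex.dual_op_def fixpoints_carrier)
  next
    case (3 n)
    have "bmeet A (dual_op (?w (Suc (Suc n)))) (bneg A (P_val A ?w (Suc n))) \<in> fixpoints"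
      using box P by (simp add: fixpoints_meet fixpoints_neg del: P_val.simps)
    note ex[OF this]
    with 3 show ?case
      by (simp add: P_val_Suc dual_op_def ex.dual_op_def del: P_val.simps)
  qed simp
qed

lemma satisfies_P_form:
  "satisfies_eq A (P_form n) Top \<longleftrightarrow> depth A \<le> enat n"
  unfolding satisfies_eq_def depth_le_iff using eval_P_form by simp

text \<open>A fixpoint equals its own \<forall>, so the sequences of elements \<forall>q are exactly
  the sequences of fixpoints.\<close>

lemma satisfies_P0_form:
  "satisfies_eq A (P0_form n) Top \<longleftrightarrow> depth (fixpoint_algebra A) \<le> enat n"
proof -
  have "(\<forall>v. range v \<subseteq> carrier A \<longrightarrow> P_val A (\<lambda>i. ex.dual_op (v i)) n = btop A) \<longleftrightarrow>
    (\<forall>v. range v \<subseteq> fixpoints \<longrightarrow> P_val A v n = btop A)" (is "?L \<longleftrightarrow> ?R")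
  proof
    assume L: ?L
    show ?R
    proof (intro allI impI)
      fix v :: "nat \<Rightarrow> 'a" assume v: "range v \<subseteq> fixpoints"
      then have "(\<lambda>i. ex.dual_op (v i)) = v" using forall_fixpoint by auto
      moreover have "range v \<subseteq> carrier A" using v fixpoints_carrier by blast
      ultimately show "P_val A v n = btop A" using L by metis
    qed
  next
    assume R: ?R
    show ?L
    proof (intro allI impI)
      fix v :: "nat \<Rightarrow> 'a" assume "range v \<subseteq> carrier A"
      then have "range (\<lambda>i. ex.dual_op (v i)) \<subseteq> fixpoints" using fixpoints_forall by auto
      then show "P_val A (\<lambda>i. ex.dual_op (v i)) n = btop A" using R by blast
    qed
  qed
  moreover have "carrier (fixpoint_algebra A) = fixpoints" "btop (fixpoint_algebra A) = btop A"
    by (simp_all add: fixpoint_algebra_def fixpoints_def)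
  ultimately show ?thesis
    unfolding satisfies_eq_def s4_algebra.depth_le_iff[OF s4_fixpoint_algebra]
    by (simp add: eval_P0_form P_val_fixpoint_algebra)
qed

text \<open>Same operations, fewer valuations.\<close>

lemma depth_fixpoint_algebra_le: "depth A \<le> enat n \<Longrightarrow> depth (fixpoint_algebra A) \<le> enat n"
  unfolding depth_le_iff s4_algebra.depth_le_iff[OF s4_fixpoint_algebra] P_val_fixpoint_algebra
  by (auto simp: fixpoint_algebra_def)

section \<open>The Casari axiom\<close>

text \<open>The Casari axiom at p = a read on points: \<box>\<forall>a holds at \<open>F\<close>
  once it holds at every \<open>H\<close> reached by a \<diamond>-step and an \<exists>-step, where
  \<box>a \<rightarrow> \<box>\<forall>a may be assumed at all successors of
  \<open>H\<close>.\<close>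

lemma casari_uf:
  assumes M: "satisfies_eq A MpCas Top" and a: "a \<in> carrier A" and F: "ultrafilter A F"
    and hyp: "\<And>G H. acc F G \<Longrightarrow> ex.acc G H \<Longrightarrow>
      (\<And>K. acc H K \<Longrightarrow> dual_op a \<in> K \<Longrightarrow> dual_op (ex.dual_op a) \<in> K) \<Longrightarrow> dual_op (ex.dual_op a) \<in> H"
  shows "dual_op (ex.dual_op a) \<in> F"
proof -
  let ?b = "dual_op (ex.dual_op a)"
  let ?s = "dual_op (bjoin A (bneg A (dual_op a)) ?b)"
  let ?t = "bjoin A (bneg A ?s) ?b"
  have c: "dual_op a \<in> carrier A" "?b \<in> carrier A" "?s \<in> carrier A" "?t \<in> carrier A"
    "ex.dual_op ?t \<in> carrier A" "dual_op (ex.dual_op ?t) \<in> carrier A"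
    using a by (simp_all add: dual_op_closed ex.dual_op_closed join_closed neg_closed)
  \<comment> \<open>The axiom under the constant valuation \<open>a\<close>; \<open>?t\<close> is
    the value of its inner implication.\<close>
  have "bjoin A (bneg A (dual_op (ex.dual_op ?t))) ?b = btop A"
    using M a unfolding satisfies_eq_def MpCas_def Let_def
    by (auto simp: dual_op_def ex.dual_op_def dest: spec[of _ "\<lambda>_. a"])
  then have imp: "dual_op (ex.dual_op ?t) \<in> F \<Longrightarrow> ?b \<in> F"
    using c F uf_join uf_neg uf_top by (metis neg_closed)
  have "?t \<in> H" if FG: "acc F G" and GH: "ex.acc G H" for G H
  proof -
    have H: "ultrafilter A H" using GH by (simp add: ex.acc_def)
    have "?b \<in> K" if "acc H K" "dual_op a \<in> K" "?s \<in> H" for K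
    proof -
      have K: "ultrafilter A K" using that by (simp add: acc_def)
      have "bjoin A (bneg A (dual_op a)) ?b \<in> K"
        using that uf_dual_op[OF H] c by (simp add: join_closed neg_closed)
      then show ?thesis using that K c by (simp add: uf_simps)
    qed
    then have "?s \<in> H \<Longrightarrow> ?b \<in> H" using hyp[OF FG GH] by blast
    then show ?thesis using H c by (auto simp: uf_simps)
  qed
  then have "dual_op (ex.dual_op ?t) \<in> F"
    using uf_dual_op[OF F c(5)] ex.uf_dual_op[OF acc_uf(2) c(4)] by blast
  with imp show ?thesis by blast
qed

text \<open>The \<box> in the assumption lets it persist along \<open>acc\<close>, and being a
  fixpoint it also persists along \<open>ex.acc\<close>; so it reaches every \<open>H\<close> of the
  Casari criterion.\<close>

lemma box_P0_le_P:
  assumes M: "satisfies_eq A MpCas Top" and v: "range v \<subseteq> carrier A"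
    and F: "ultrafilter A F"
    and c: "dual_op (P_val A (\<lambda>i. ex.dual_op (P_val A v i)) n) \<in> F"
  shows "P_val A v n \<in> F"
  using F c
proof (induction n arbitrary: F)
  case 0
  then show ?case using uf_dual_op acc_refl bot_closed by fastforce
next
  case (Suc n)
  let ?w = "\<lambda>i. ex.dual_op (P_val A v i)"
  let ?a = "P_val A v" and ?c = "P_val A ?w"
  let ?b = "dual_op (?w (Suc n))" and ?q = "dual_op (v (Suc n))"
  have a: "?a i \<in> carrier A" for i using P_val_closed v .
  have w: "range ?w \<subseteq> fixpoints" using fixpoints_forall a by auto
  then have wc: "range ?w \<subseteq> carrier A" using fixpoints_carrier by blast
  have cc: "?c i \<in> carrier A" for i using P_val_closed wc .
  have q: "v (Suc n) \<in> carrier A" using v by auto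
  have open_b: "?b \<in> G'" if "acc G G'" "?b \<in> G" for G G'
    using dual_op_acc[OF that(1) _ that(2)] wc by blast
  \<comment> \<open>The stronger \<box>\<forall>a for a = \<open>?a (Suc n)\<close> is proved, so
    that the Casari criterion applies.\<close>
  have "?b \<in> F"
  proof (rule casari_uf[OF M a Suc.prems(1)])
    fix G H assume G: "acc F G" "ex.acc G H"
      and imp: "\<And>K. acc H K \<Longrightarrow> dual_op (?a (Suc n)) \<in> K \<Longrightarrow> ?b \<in> K"
    have H: "ultrafilter A H" using G by (simp add: ex.acc_def)
    have "dual_op (?c (Suc n)) \<in> G"
      using dual_op_acc[OF G(1) cc Suc.prems(2)] .
    moreover have "dual_op (?c (Suc n)) \<in> fixpoints" using fixpoints_box P_val_fixpoint w .
    ultimately have "dual_op (?c (Suc n)) \<in> H" using G ex_acc_sym fixpoints_iff by blast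
    then have "?c (Suc n) \<in> H" using H cc acc_refl uf_dual_op by blast
    then have cH: "?b \<in> H" if "acc H K" "?b \<in> K" "?c n \<notin> K" for K
      using that uf_P_val_Suc[OF H wc] by blast
    show "?b \<in> H"
    \<comment> \<open>The question is whether the antecedent of the formula with index
      \<open>Suc n\<close> holds at \<open>H\<close>.\<close>
    proof (cases "\<exists>K. acc H K \<and> ?q \<in> K \<and> ?a n \<notin> K")
      case True
      then obtain K where K: "acc H K" "?q \<in> K" "?a n \<notin> K" by blast
      then have ufK: "ultrafilter A K" by (simp add: acc_def)
      \<comment> \<open>The consequent \<open>?q\<close> persists from \<open>K\<close> to all its
        successors, so \<open>K\<close> satisfies \<box> of \<open>?a (Suc n)\<close> and
        \<open>imp\<close> applies to it.\<close>
      have "?a (Suc n) \<in> L" if KL: "acc K L" for L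
      proof -
        have "?q \<in> L" using dual_op_acc[OF KL q K(2)] .
        then show ?thesis using uf_P_val_Suc[OF acc_uf(2)[OF KL] v] by blast
      qed
      then have bK: "?b \<in> K" using imp K(1) uf_dual_op ufK a by blast
      \<comment> \<open>By the contrapositive of the induction hypothesis \<open>K\<close> sees a
        point \<open>L\<close> without \<open>?c n\<close>. It inherits \<open>?b\<close> from
        \<open>K\<close>, hence is the witness that \<open>cH\<close> asks for.\<close>
      have "dual_op (?c n) \<notin> K" using Suc.IH[OF ufK] K by blast
      then obtain L where "acc K L" "?c n \<notin> L" using uf_dual_op ufK cc by blast
      then show ?thesis using cH K(1) acc_trans open_b bK by blast
    next
      case False
      \<comment> \<open>By transitivity the antecedent fails at every successor of \<open>H\<close>
        too, so the implication holds there and \<open>imp\<close> applies at \<open>H\<close>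
        itself.\<close>
      have "?a (Suc n) \<in> L" if "acc H L" for L
        using False acc_trans[OF that] uf_P_val_Suc[OF acc_uf(2)[OF that] v] by blast
      then show ?thesis using imp acc_refl H uf_dual_op a by blast
    qed
  qed
  \<comment> \<open>Reflexivity of \<open>acc\<close> and then of \<open>ex.acc\<close> strips
    \<box> and \<forall>.\<close>
  then have "?w (Suc n) \<in> F" using uf_dual_op Suc.prems acc_refl wc by blast
  then show ?case using ex.uf_dual_op Suc.prems ex.acc_refl a by blast
qed

lemma depth_le_fixpoint_algebra:
  assumes M: "satisfies_eq A MpCas Top" and d: "depth (fixpoint_algebra A) \<le> enat n"
  shows "depth A \<le> enat n"
  unfolding depth_le_iff
proof (intro allI impI)
  fix v :: "nat \<Rightarrow> 'a" assume v: "range v \<subseteq> carrier A"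
  let ?a = "P_val A v"
  have a: "?a i \<in> carrier A" for i using P_val_closed v .
  \<comment> \<open>Validity of \<open>P0_form n\<close> is used under the valuation
    \<open>?a\<close>, where the i-th variable is the value of the i-th depth formula.\<close>
  have "P_val A (\<lambda>i. ex.dual_op (?a i)) n = btop A"
  proof -
    have ra: "range ?a \<subseteq> carrier A" using a by blast
    moreover have "satisfies_eq A (P0_form n) Top" using d satisfies_P0_form by blast
    ultimately have "eval A ?a (P0_form n) = btop A" unfolding satisfies_eq_def by simp
    then show ?thesis using eval_P0_form[OF ra] by simp
  qed
  then have "dual_op (P_val A (\<lambda>i. ex.dual_op (?a i)) n) \<in> F" if "ultrafilter A F" for F
    using that uf_dual_op top_closed uf_top unfolding acc_def by simp
  then have "?a n \<in> F" if "ultrafilter A F" for F using box_P0_le_P[OF M v] that by blast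
  then show "?a n = btop A" by (subst eq_iff_uf) (auto simp: a top_closed uf_top)
qed

end

theorem theorem4p13:
  fixes V :: "'a ms4_alg set" and n :: nat
  assumes "variety V" and "V \<subseteq> MpS4"
  shows "(var_depth V \<le> enat n \<longleftrightarrow> var_depth0 V \<le> enat n) \<and>
         (valid V (P_form n) \<longleftrightarrow> valid V (P0_form n))"
proof -
  have ms4: "ms4_algebra A" "satisfies_eq A MpCas Top" if "A \<in> V" for A
    using assms(2) that by (auto simp: MpS4_def MS4_def)
  \<comment> \<open>The equivalence holds algebra by algebra; bounds on suprema and validity over
    \<open>V\<close> then follow.\<close>
  then have "depth A \<le> enat n \<longleftrightarrow> depth (fixpoint_algebra A) \<le> enat n" if "A \<in> V" for A
    using that ms4_algebra.depth_fixpoint_algebra_le ms4_algebra.depth_le_fixpoint_algebra by blast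
  then show ?thesis
    using ms4 by (simp add: var_depth_def var_depth0_def SUP_le_iff valid_def
        ms4_algebra.satisfies_P_form ms4_algebra.satisfies_P0_form)
qed

end
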